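(* Let $m = m(n)$, $h = h(n)$ and $\sigma = \sigma(n)$ be computable from $n$ and satisfy $0 < \sigma < 1$, $h > 0$, $0 < m < n$, and $m = \omega(\log n + h)$. Let $H = 2^{h+1} - 1$. Let $f : \{0,1\}^n \times \{0,1\}^h \to \{0,1\}^m$ be a computable ensemble of functions such that for every $x \in \{0,1\}^n$ with $C(x) \geq \sigma n$ there exists a string $\alpha_x \in \{0,1\}^h$ with $C(f(x,\alpha_x)) \geq (1-\epsilon) m$. Then $\epsilon \geq \frac{1-\sigma}{H} - o(1)$.
   Context: $C(u)$ denotes the plain Kolmogorov complexity of $u$ with respect to a fixed universal Turing machine. An ensemble $f : \{0,1\}^n \times \{0,1\}^h \to \{0,1\}^m$ means a family $(f_n)_{n \in \mathbb{N}}$ with $f_n : \{0,1\}^n \times \{0,1\}^{h(n)} \to \{0,1\}^{m(n)}$; it is computable if $(n, x, \alpha) \mapsto f_n(x,\alpha)$ is computable. The $o(1)$ is as $n \to \infty$. *)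

theory Defs
  imports Complex_Main "HOL-Library.Landau_Symbols" "HOL-Library.Nat_Bijection"
begin

section \<open>Partial recursive functions\<close>

text \<open>Computability is fixed as partial recursiveness. Terms carry no arity; a term applied to
  too short an argument list is undefined, and superfluous arguments are ignored. For each fixed
  number of arguments this yields exactly the partial recursive functions of that arity.\<close>

datatype recf =
    Zero
  | Succ
  | Proj nat
  | Comp recf "recf list"
  | PrimRec recf recf
  | Mu recf

fun eval :: "recf \<Rightarrow> nat list \<Rightarrow> nat option" where
  "eval Zero xs = Some 0"
| "eval Succ xs = (case xs of [] \<Rightarrow> None | x # _ \<Rightarrow> Some (Suc x))"
| "eval (Proj i) xs = (if i < length xs then Some (xs ! i) else None)"
| "eval (Comp f gs) xs =
     (if \<forall>g \<in> set gs. eval g xs \<noteq> None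
      then eval f (map (\<lambda>g. the (eval g xs)) gs) else None)"
| "eval (PrimRec f g) xs =
     (case xs of [] \<Rightarrow> None
      | n # ys \<Rightarrow> rec_nat (eval f ys)
                   (\<lambda>k r. case r of None \<Rightarrow> None | Some v \<Rightarrow> eval g (k # v # ys)) n)"
| "eval (Mu f) xs =
     (if \<exists>n. eval f (n # xs) = Some 0 \<and> (\<forall>i<n. eval f (i # xs) \<noteq> None)
      then Some (LEAST n. eval f (n # xs) = Some 0) else None)"

section \<open>Computable objects\<close>

text \<open>Binary strings are identified with natural numbers by bijective base-2 numeration (digits
  1 and 2, least significant digit first).\<close>

fun str_code :: "bool list \<Rightarrow> nat" where
  "str_code [] = 0"
| "str_code (b # bs) = 2 * str_code bs + (if b then 2 else 1)"

lemma bij_str_code: "bij str_code"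
proof (rule bijI)
  show "inj str_code"
  proof (rule injI)
    fix x y assume "str_code x = str_code y"
    then show "x = y"
    proof (induction x arbitrary: y)
      case Nil
      then show ?case by (cases y) (auto split: if_splits)
    next
      case (Cons a x)
      then obtain b z where y: "y = b # z" by (cases y) (auto split: if_splits)
      have "a = b \<and> str_code x = str_code z"
        using Cons.prems unfolding y by (auto split: if_splits) presburger+
      then show ?case using Cons.IH y by blast
    qed
  qed
  show "surj str_code"
  proof -
    have "\<exists>x. n = str_code x" for n
    proof (induction n rule: less_induct)
      case (less n)
      show ?case
      proof (cases "n = 0")
        case True
        then show ?thesis by (metis str_code.simps(1))
      next
        case False
        then obtain x where x: "(n - 1) div 2 = str_code x"
          using less.IH[of "(n - 1) div 2"] by (metis bot_nat_0.not_eq_extremum diff_less div_le_dividend le_less_trans less_one)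
        have "n = str_code ((even n) # x)"
          using False x[symmetric] by (simp, presburger)
        then show ?thesis by blast
      qed
    qed
    then show ?thesis by (simp add: surj_def)
  qed
qed

definition computable_nat :: "(nat \<Rightarrow> nat) \<Rightarrow> bool" where
  "computable_nat g \<longleftrightarrow> (\<exists>r. \<forall>n. eval r [n] = Some (g n))"

text \<open>A sequence of reals is computable if dyadic approximations to its members can be computed
  uniformly to any prescribed accuracy. The numerator is an integer, hence the decoding.\<close>

definition computable_real_seq :: "(nat \<Rightarrow> real) \<Rightarrow> bool" where
  "computable_real_seq s \<longleftrightarrow>
     (\<exists>r. \<forall>n k. \<exists>p. eval r [n, k] = Some p \<and>
        \<bar>s n - of_int (int_decode p) / 2 ^ k\<bar> \<le> 1 / 2 ^ k)"

definition partial_computable :: "(bool list \<Rightarrow> bool list option) \<Rightarrow> bool" where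
  "partial_computable V \<longleftrightarrow>
     (\<exists>r. \<forall>p. eval r [str_code p] = map_option str_code (V p))"

definition bitstrings :: "nat \<Rightarrow> bool list set" where
  "bitstrings n = {x. length x = n}"

text \<open>Only the values of \<open>f n\<close> on strings of lengths \<open>n\<close> and \<open>h n\<close> are relevant.\<close>

definition computable_ensemble ::
    "(nat \<Rightarrow> nat) \<Rightarrow> (nat \<Rightarrow> bool list \<Rightarrow> bool list \<Rightarrow> bool list) \<Rightarrow> bool" where
  "computable_ensemble h f \<longleftrightarrow>
     (\<exists>r. \<forall>n. \<forall>x \<in> bitstrings n. \<forall>\<alpha> \<in> bitstrings (h n).
        eval r [n, str_code x, str_code \<alpha>] = Some (str_code (f n x \<alpha>)))"

section \<open>Plain Kolmogorov complexity\<close>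

text \<open>A machine is universal if it is partial computable and simulates every other machine with
  programs longer by at most an additive constant; this is the property that makes complexity
  well defined up to a constant. Machines that simulate \<open>V\<close> on \<open>p\<close> by running
  \<open>w @ p\<close>, for a fixed string \<open>w\<close> depending on \<open>V\<close>, are a special case.\<close>

definition universal_machine :: "(bool list \<Rightarrow> bool list option) \<Rightarrow> bool" where
  "universal_machine U \<longleftrightarrow> partial_computable U \<and>
     (\<forall>V. partial_computable V \<longrightarrow>
        (\<exists>c. \<forall>p u. V p = Some u \<longrightarrow>
           (\<exists>q. U q = Some u \<and> length q \<le> length p + c)))"

definition plain_complexity :: "(bool list \<Rightarrow> bool list option) \<Rightarrow> bool list \<Rightarrow> nat" where
  "plain_complexity U u = (LEAST k. \<exists>p. length p = k \<and> U p = Some u)"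

end

theory Submission
  imports Defs "HOL-Library.FuncSet"
begin

text \<open>Put \<open>k = \<lfloor>(1 - \<sigma>) m / H\<rfloor>\<close>. Call two strings of length \<open>n\<close> equivalent if, for each of the \<open>2\<^sup>h\<close> seeds,
  the codes of their images agree modulo \<open>2\<^sup>k\<close>. There are at most \<open>2\<close> to the power \<open>k 2\<^sup>h \<le> (1 - \<sigma>) n\<close> classes, so some
  class has size at least \<open>2\<close> to the power \<open>\<sigma> n\<close> and contains a string \<open>x\<close> of complexity at least \<open>\<sigma> n\<close>. The
  first such class is found by search from \<open>n\<close> and \<open>k\<close>; it determines the residues, so each
  \<open>f(x, \<alpha>)\<close> is determined by \<open>n\<close>, \<open>k\<close>, \<open>\<alpha>\<close> and a quotient of about \<open>m - k\<close> bits. Thus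
  \<open>(1 - \<epsilon>) m \<le> m - k + O(log n + h)\<close>, and the error term is \<open>o(m)\<close>.\<close>

section \<open>Closure properties of total computable functions\<close>

text \<open>Terms of type \<open>recf\<close> carry no arity, so correctness is demanded only on
  lists of length \<open>a\<close>. Total functions suffice, because every search made below
  succeeds.\<close>

definition computable_fun :: "nat \<Rightarrow> (nat list \<Rightarrow> nat) \<Rightarrow> bool" where
  "computable_fun a g \<longleftrightarrow> (\<exists>r. \<forall>xs. length xs = a \<longrightarrow> eval r xs = Some (g xs))"

lemma computable_fun_cong:
  assumes "computable_fun a f" "\<And>xs. length xs = a \<Longrightarrow> f xs = g xs"
  shows "computable_fun a g"
  using assms unfolding computable_fun_def by metis

lemma computable_fun_nth: "i < a \<Longrightarrow> computable_fun a (\<lambda>xs. xs ! i)"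
  unfolding computable_fun_def by (rule exI[of _ "Proj i"]) simp

lemma computable_fun_hd: "0 < a \<Longrightarrow> computable_fun a hd"
  by (rule computable_fun_cong[OF computable_fun_nth[of 0]]) (auto simp: hd_conv_nth)

lemma computable_fun_comp:
  assumes "computable_fun (length gs) g" "\<And>f. f \<in> set gs \<Longrightarrow> computable_fun a f"
  shows "computable_fun a (\<lambda>xs. g (map (\<lambda>f. f xs) gs))"
proof -
  obtain r where r: "\<And>xs. length xs = length gs \<Longrightarrow> eval r xs = Some (g xs)"
    using assms(1) unfolding computable_fun_def by blast
  obtain R where R: "\<And>f xs. f \<in> set gs \<Longrightarrow> length xs = a \<Longrightarrow> eval (R f) xs = Some (f xs)"
    using assms(2) unfolding computable_fun_def by metis
  have "eval (Comp r (map R gs)) xs = Some (g (map (\<lambda>f. f xs) gs))" if "length xs = a" for xs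
  proof -
    have "map (\<lambda>r. the (eval r xs)) (map R gs) = map (\<lambda>f. f xs) gs"
      using R that by simp
    moreover have "\<forall>r\<in>set (map R gs). eval r xs \<noteq> None"
      using R that by auto
    ultimately show ?thesis using r[of "map (\<lambda>f. f xs) gs"] by (simp del: map_map)
  qed
  then show ?thesis unfolding computable_fun_def by blast
qed

lemma computable_fun_comp1:
  assumes "computable_fun 1 (\<lambda>xs. g (xs ! 0))" "computable_fun a f"
  shows "computable_fun a (\<lambda>xs. g (f xs))"
  using computable_fun_comp[of "[f]" "\<lambda>xs. g (xs ! 0)" a] assms by simp

text \<open>Recursion, sums and search put their bound variable at the head of the argument list;
  this carries the parameters past it.\<close>

lemma computable_fun_tl:
  assumes "computable_fun a f"
  shows "computable_fun (Suc a) (\<lambda>ys. f (tl ys))"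
proof -
  have "computable_fun (Suc a) (\<lambda>ys. f (map (\<lambda>p. p ys) (map (\<lambda>i ys. ys ! Suc i) [0..<a])))"
    by (rule computable_fun_comp) (use assms computable_fun_nth in auto)
  then show ?thesis
  proof (rule computable_fun_cong)
    fix xs :: "nat list" assume "length xs = Suc a"
    then have "map (\<lambda>p. p xs) (map (\<lambda>i ys. ys ! Suc i) [0..<a]) = tl xs"
      by (intro nth_equalityI) (auto simp: nth_tl)
    then show "f (map (\<lambda>p. p xs) (map (\<lambda>i ys. ys ! Suc i) [0..<a])) = f (tl xs)" by simp
  qed
qed

lemma computable_fun_Suc:
  assumes "computable_fun a f"
  shows "computable_fun a (\<lambda>xs. Suc (f xs))"
proof (rule computable_fun_comp1[OF _ assms])
  have "eval Succ xs = Some (Suc (xs ! 0))" if "length xs = 1" for xs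
    using that by (cases xs) auto
  then show "computable_fun 1 (\<lambda>xs. Suc (xs ! 0))"
    unfolding computable_fun_def by blast
qed

lemma computable_fun_const: "computable_fun a (\<lambda>xs. c)"
proof (induction c)
  case 0
  show ?case unfolding computable_fun_def by (rule exI[of _ Zero]) simp
next
  case (Suc c)
  then show ?case by (rule computable_fun_Suc)
qed

lemma computable_fun_rec_nat:
  assumes b: "computable_fun a b"
    and s: "computable_fun (Suc (Suc a)) (\<lambda>ys. s (tl (tl ys)) (hd ys) (hd (tl ys)))"
    and c: "computable_fun a c"
  shows "computable_fun a (\<lambda>xs. rec_nat (b xs) (s xs) (c xs))"
proof -
  obtain rb where rb: "\<And>xs. length xs = a \<Longrightarrow> eval rb xs = Some (b xs)"
    using b unfolding computable_fun_def by blast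
  obtain rs where "\<And>ys. length ys = Suc (Suc a) \<Longrightarrow>
      eval rs ys = Some (s (tl (tl ys)) (hd ys) (hd (tl ys)))"
    using s unfolding computable_fun_def by blast
  then have rs: "eval rs (k # v # xs) = Some (s xs k v)" if "length xs = a" for k v xs
    using that by simp
  have "eval (PrimRec rb rs) (n # xs) = Some (rec_nat (b xs) (s xs) n)" if "length xs = a" for n xs
    using that by (induction n) (simp_all add: rb rs)
  then have *: "computable_fun (Suc a) (\<lambda>ys. rec_nat (b (tl ys)) (s (tl ys)) (hd ys))"
    unfolding computable_fun_def by (intro exI[of _ "PrimRec rb rs"]) (auto simp: length_Suc_conv)
  \<comment> \<open>\<open>PrimRec\<close> recurses on its first argument, so the value of
    \<open>c\<close> is placed in front of the unchanged parameters.\<close>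
  let ?gs = "c # map (\<lambda>i xs. xs ! i) [0..<a]"
  have "computable_fun a (\<lambda>xs. (\<lambda>ys. rec_nat (b (tl ys)) (s (tl ys)) (hd ys)) (map (\<lambda>f. f xs) ?gs))"
    by (rule computable_fun_comp) (use * c computable_fun_nth in auto)
  then show ?thesis
  proof (rule computable_fun_cong)
    fix xs :: "nat list" assume "length xs = a"
    then have "map (\<lambda>f. f xs) (map (\<lambda>i xs. xs ! i) [0..<a]) = xs"
      by (intro nth_equalityI) auto
    then show "(\<lambda>ys. rec_nat (b (tl ys)) (s (tl ys)) (hd ys)) (map (\<lambda>f. f xs) ?gs)
        = rec_nat (b xs) (s xs) (c xs)" by simp
  qed
qed

text \<open>Since \<open>g\<close> is total, \<open>Mu\<close> meets no undefined value below the
  least zero, and \<open>ex\<close> makes the search end.\<close>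

lemma computable_fun_Least:
  assumes "computable_fun (Suc a) (\<lambda>ys. g (tl ys) (hd ys))"
    and ex: "\<And>xs. length xs = a \<Longrightarrow> \<exists>n. g xs n = 0"
  shows "computable_fun a (\<lambda>xs. LEAST n. g xs n = 0)"
proof -
  obtain r where "\<And>ys. length ys = Suc a \<Longrightarrow> eval r ys = Some (g (tl ys) (hd ys))"
    using assms(1) unfolding computable_fun_def by blast
  then have r: "eval r (n # xs) = Some (g xs n)" if "length xs = a" for n xs
    using that by simp
  have "eval (Mu r) xs = Some (LEAST n. g xs n = 0)" if "length xs = a" for xs
    using ex[OF that] by (simp add: r[OF that])
  then show ?thesis unfolding computable_fun_def by blast
qed

lemma computable_fun_add:
  assumes "computable_fun a f" "computable_fun a g"
  shows "computable_fun a (\<lambda>xs. f xs + g xs)"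
proof -
  have "computable_fun a (\<lambda>xs. rec_nat (f xs) (\<lambda>_. Suc) (g xs))"
    by (intro computable_fun_rec_nat assms computable_fun_Suc computable_fun_tl computable_fun_hd) simp
  moreover have "rec_nat x (\<lambda>_. Suc) y = x + y" for x y by (induction y) auto
  ultimately show ?thesis by simp
qed

lemma computable_fun_sum:
  assumes g: "computable_fun (Suc a) (\<lambda>ys. g (tl ys) (hd ys))" and b: "computable_fun a b"
  shows "computable_fun a (\<lambda>xs. \<Sum>i<b xs. g xs i)"
proof -
  \<comment> \<open>The recursion step receives counter, partial sum and parameters; this selection
    drops the partial sum, on which \<open>g\<close> does not depend.\<close>
  let ?gs = "(\<lambda>ys. ys ! 0) # map (\<lambda>i ys. ys ! Suc (Suc i)) [0..<a]"
  have "computable_fun (Suc (Suc a)) (\<lambda>ys. (\<lambda>ys. g (tl ys) (hd ys)) (map (\<lambda>f. f ys) ?gs))"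
    by (rule computable_fun_comp) (use g computable_fun_nth in auto)
  then have "computable_fun (Suc (Suc a)) (\<lambda>ys. g (tl (tl ys)) (hd ys))"
  proof (rule computable_fun_cong)
    fix ys :: "nat list" assume len: "length ys = Suc (Suc a)"
    then have "map (\<lambda>f. f ys) (map (\<lambda>i ys. ys ! Suc (Suc i)) [0..<a]) = tl (tl ys)"
      by (intro nth_equalityI) (auto simp: nth_tl)
    then show "(\<lambda>ys. g (tl ys) (hd ys)) (map (\<lambda>f. f ys) ?gs) = g (tl (tl ys)) (hd ys)"
      using len by (cases ys) auto
  qed
  then have "computable_fun a (\<lambda>xs. rec_nat 0 (\<lambda>k v. v + g xs k) (b xs))"
    by (intro computable_fun_rec_nat computable_fun_const b computable_fun_add
        computable_fun_tl computable_fun_hd) auto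
  moreover have "rec_nat 0 (\<lambda>k v. v + g xs k) n = (\<Sum>i<n. g xs i)" for xs n
    by (induction n) auto
  ultimately show ?thesis by simp
qed

lemma computable_fun_mult:
  assumes "computable_fun a f" "computable_fun a g"
  shows "computable_fun a (\<lambda>xs. f xs * g xs)"
proof -
  have "computable_fun a (\<lambda>xs. \<Sum>i<f xs. g xs)"
    by (intro computable_fun_sum assms computable_fun_tl)
  then show ?thesis by simp
qed

lemma computable_fun_diff:
  assumes "computable_fun a f" "computable_fun a g"
  shows "computable_fun a (\<lambda>xs. f xs - g xs)"
proof -
  have pred: "computable_fun a (\<lambda>xs. f xs - 1)" if "computable_fun a f" for a f
  proof -
    have "computable_fun a (\<lambda>xs. rec_nat 0 (\<lambda>k v. k) (f xs))"
      by (intro computable_fun_rec_nat that computable_fun_const computable_fun_hd) simp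
    moreover have "rec_nat 0 (\<lambda>k v. k) n = n - 1" for n :: nat by (cases n) auto
    ultimately show ?thesis by simp
  qed
  have "computable_fun a (\<lambda>xs. rec_nat (f xs) (\<lambda>k v. v - 1) (g xs))"
    by (intro computable_fun_rec_nat assms pred computable_fun_tl computable_fun_hd) simp
  moreover have "rec_nat x (\<lambda>k v. v - 1) y = x - y" for x y :: nat by (induction y) auto
  ultimately show ?thesis by simp
qed

lemma computable_fun_power2:
  assumes "computable_fun a f"
  shows "computable_fun a (\<lambda>xs. 2 ^ f xs)"
proof -
  have "computable_fun a (\<lambda>xs. rec_nat 1 (\<lambda>k v. 2 * v) (f xs))"
    by (intro computable_fun_rec_nat assms computable_fun_const computable_fun_mult
        computable_fun_tl computable_fun_hd) simp
  moreover have "rec_nat 1 (\<lambda>k v. 2 * v) n = (2::nat) ^ n" for n by (induction n) auto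
  ultimately show ?thesis by simp
qed

lemma computable_fun_div_power2:
  assumes "computable_fun a f" "computable_fun a g"
  shows "computable_fun a (\<lambda>xs. f xs div 2 ^ g xs)"
proof -
  \<comment> \<open>The quotient is the least \<open>q\<close> with
    \<open>x < Suc q * 2 ^ j\<close>; truncated subtraction turns this inequality into a test for
    zero.\<close>
  have *: "(Suc x - Suc q * 2 ^ j = 0) \<longleftrightarrow> x div 2 ^ j \<le> q" for x q j :: nat
    by (simp add: Suc_le_eq div_less_iff_less_mult flip: less_Suc_eq_le mult_Suc)
  have "computable_fun a (\<lambda>xs. LEAST q. Suc (f xs) - Suc q * 2 ^ g xs = 0)"
  proof (rule computable_fun_Least)
    fix xs show "\<exists>q. Suc (f xs) - Suc q * 2 ^ g xs = 0" unfolding * by blast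
  qed (intro computable_fun_diff computable_fun_Suc computable_fun_mult computable_fun_power2
      computable_fun_tl computable_fun_hd assms, simp)
  moreover have "(LEAST q. Suc x - Suc q * 2 ^ j = 0) = x div 2 ^ j" for x j :: nat
    unfolding * by (rule Least_equality) auto
  ultimately show ?thesis by simp
qed

lemma computable_fun_mod_power2:
  assumes "computable_fun a f" "computable_fun a g"
  shows "computable_fun a (\<lambda>xs. f xs mod 2 ^ g xs)"
proof -
  have "computable_fun a (\<lambda>xs. f xs - f xs div 2 ^ g xs * 2 ^ g xs)"
    by (intro computable_fun_diff computable_fun_mult computable_fun_power2
        computable_fun_div_power2 assms)
  then show ?thesis by (simp add: minus_div_mult_eq_mod)
qed

lemmas computable_fun_arith =
  computable_fun_const computable_fun_Suc computable_fun_add computable_fun_mult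
  computable_fun_diff computable_fun_power2 computable_fun_div_power2 computable_fun_mod_power2


lemma computable_nat_comp:
  assumes "computable_nat g" "computable_fun a f"
  shows "computable_fun a (\<lambda>xs. g (f xs))"
proof (rule computable_fun_comp1[OF _ assms(2)])
  obtain r where "\<And>n. eval r [n] = Some (g n)"
    using assms(1) unfolding computable_nat_def by blast
  then have "eval r xs = Some (g (xs ! 0))" if "length xs = 1" for xs
    using that by (cases xs) auto
  then show "computable_fun 1 (\<lambda>xs. g (xs ! 0))"
    unfolding computable_fun_def by blast
qed

section \<open>Numbering the strings of a given length\<close>

lemma str_code_lower: "2 ^ length x \<le> Suc (str_code x)"
  by (induction x) auto

lemma str_code_upper: "str_code x + 2 \<le> 2 ^ Suc (length x)"
  by (induction x) auto

text \<open>Strings of length \<open>n\<close> have exactly the codes from \<open>2 ^ n - 1\<close>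
  to \<open>2 ^ Suc n - 2\<close>, so \<open>y < 2 ^ n\<close> serves as an offset into this
  interval.\<close>

definition nth_string :: "nat \<Rightarrow> nat \<Rightarrow> bool list" where
  "nth_string n y = inv str_code (2 ^ n - 1 + y)"

lemma str_code_inv: "str_code (inv str_code y) = y"
  using bij_str_code by (simp add: bij_is_surj surj_f_inv_f)

lemma inv_str_code: "inv str_code (str_code x) = x"
  using bij_str_code by (simp add: bij_is_inj inv_f_f)

lemma str_code_nth_string: "str_code (nth_string n y) = 2 ^ n - 1 + y"
  by (simp add: nth_string_def str_code_inv)

lemma nth_string_bitstrings:
  assumes "y < 2 ^ n"
  shows "nth_string n y \<in> bitstrings n"
proof -
  let ?l = "length (nth_string n y)"
  have "(2::nat) ^ ?l < 2 ^ Suc n" "(2::nat) ^ n < 2 ^ Suc ?l"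
    using str_code_lower[of "nth_string n y"] str_code_upper[of "nth_string n y"] assms
    by (auto simp: str_code_nth_string)
  then have "?l < Suc n" "n < Suc ?l" by (meson nat_power_less_imp_less pos2)+
  then show ?thesis by (simp add: bitstrings_def)
qed

lemma ex_nth_string:
  assumes "x \<in> bitstrings n"
  obtains y where "y < 2 ^ n" "x = nth_string n y"
proof
  have "2 ^ n \<le> Suc (str_code x)" "str_code x + 2 \<le> 2 ^ Suc n"
    using str_code_lower[of x] str_code_upper[of x] assms by (auto simp: bitstrings_def)
  then show "Suc (str_code x) - 2 ^ n < 2 ^ n" "x = nth_string n (Suc (str_code x) - 2 ^ n)"
    by (auto simp: nth_string_def inv_str_code)
qed

lemma inj_nth_string: "inj (nth_string n)"
proof (rule injI)
  fix x y assume "nth_string n x = nth_string n y"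
  then have "str_code (nth_string n x) = str_code (nth_string n y)" by simp
  then have "2 ^ n - 1 + x = 2 ^ n - 1 + y" by (simp only: str_code_nth_string)
  then show "x = y" by (rule add_left_imp_eq)
qed

section \<open>Plain complexity and counting of programs\<close>

lemma plain_complexity_le: "U p = Some u \<Longrightarrow> plain_complexity U u \<le> length p"
  unfolding plain_complexity_def by (rule Least_le) blast

lemma plain_complexity_le_machine:
  assumes "universal_machine U" "partial_computable V"
  obtains c where "\<And>p u. V p = Some u \<Longrightarrow> plain_complexity U u \<le> length p + c"
  using assms plain_complexity_le unfolding universal_machine_def by (metis le_trans)

text \<open>This is the identity machine. A universal machine simulates it, so every string has a
  program and the \<open>LEAST\<close> in \<open>plain_complexity\<close> is attained.\<close>

lemma partial_computable_Some: "partial_computable Some"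
  unfolding partial_computable_def by (rule exI[of _ "Proj 0"]) simp

lemma ex_shortest_program:
  assumes "universal_machine U"
  shows "\<exists>p. length p = plain_complexity U u \<and> U p = Some u"
proof -
  obtain p where "U p = Some u"
    using assms partial_computable_Some unfolding universal_machine_def by blast
  then have "\<exists>k p. length p = k \<and> U p = Some u" by blast
  then show ?thesis unfolding plain_complexity_def by (rule LeastI_ex)
qed

text \<open>There are fewer than \<open>2 ^ t\<close> programs of length below \<open>t\<close>, and
  each outputs at most one string.\<close>

lemma ex_complex_string:
  assumes U: "universal_machine U" and "finite A" and A: "2 ^ t \<le> card A"
  shows "\<exists>x\<in>A. t \<le> plain_complexity U x"
proof (rule ccontr)
  assume *: "\<not> ?thesis"
  let ?P = "{p :: bool list. length p < t}"
  have sub: "str_code ` ?P \<subseteq> {..<2 ^ t - 1}"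
  proof
    fix y assume "y \<in> str_code ` ?P"
    then obtain p where p: "length p < t" "y = str_code p" by blast
    have "(2::nat) ^ Suc (length p) \<le> 2 ^ t" using p by (intro power_increasing) auto
    then show "y \<in> {..<2 ^ t - 1}" using str_code_upper[of p] p by auto
  qed
  have inj: "inj_on str_code ?P"
    using bij_str_code by (meson bij_is_inj inj_on_subset subset_UNIV)
  have fin: "finite ?P"
    using inj sub by (meson finite_imageD finite_lessThan finite_subset)
  have "card ?P \<le> 2 ^ t - 1"
    using card_inj_on_le[OF inj sub] by simp
  moreover have "A \<subseteq> (\<lambda>p. the (U p)) ` ?P"
  proof
    fix x assume "x \<in> A"
    then have "plain_complexity U x < t" using * by force
    moreover obtain p where "length p = plain_complexity U x" "U p = Some x"
      using ex_shortest_program[OF U] by blast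
    ultimately show "x \<in> (\<lambda>p. the (U p)) ` ?P" by (intro image_eqI[of _ _ p]) auto
  qed
  then have "card A \<le> card ?P"
    using fin by (meson card_image_le card_mono finite_imageI le_trans)
  ultimately have "card A \<le> 2 ^ t - 1" by simp
  moreover have "(0::nat) < 2 ^ t" by simp
  ultimately show False using A by linarith
qed

section \<open>Residue classes and a large class found by search\<close>

text \<open>The reductions modulo powers of two make this a total function.\<close>

definition ensemble_code ::
    "(nat \<Rightarrow> nat) \<Rightarrow> (nat \<Rightarrow> bool list \<Rightarrow> bool list \<Rightarrow> bool list) \<Rightarrow> nat \<Rightarrow> nat \<Rightarrow> nat \<Rightarrow> nat" where
  "ensemble_code h f n x \<alpha> =
     str_code (f n (nth_string n (x mod 2 ^ n)) (nth_string (h n) (\<alpha> mod 2 ^ h n)))"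

definition residue ::
    "(nat \<Rightarrow> nat) \<Rightarrow> (nat \<Rightarrow> bool list \<Rightarrow> bool list \<Rightarrow> bool list) \<Rightarrow> nat \<Rightarrow> nat \<Rightarrow> nat \<Rightarrow> nat \<Rightarrow> nat" where
  "residue h f n k x \<alpha> = ensemble_code h f n x \<alpha> mod 2 ^ k"

text \<open>Of the two truncated differences one vanishes, so this is the l1 distance of the residue
  vectors: equality of vectors becomes a computable test for zero.\<close>

definition residue_distance ::
    "(nat \<Rightarrow> nat) \<Rightarrow> (nat \<Rightarrow> bool list \<Rightarrow> bool list \<Rightarrow> bool list) \<Rightarrow> nat \<Rightarrow> nat \<Rightarrow> nat \<Rightarrow> nat \<Rightarrow> nat" where
  "residue_distance h f n k x y =
     (\<Sum>\<alpha><2 ^ h n. (residue h f n k x \<alpha> - residue h f n k y \<alpha>)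
                  + (residue h f n k y \<alpha> - residue h f n k x \<alpha>))"

text \<open>The truncated term \<open>1 - d\<close> is the indicator of
  \<open>d = 0\<close>.\<close>

definition class_size ::
    "(nat \<Rightarrow> nat) \<Rightarrow> (nat \<Rightarrow> bool list \<Rightarrow> bool list \<Rightarrow> bool list) \<Rightarrow> nat \<Rightarrow> nat \<Rightarrow> nat \<Rightarrow> nat" where
  "class_size h f n k y = (\<Sum>x<2 ^ n. 1 - residue_distance h f n k x y)"

text \<open>The equation encodes
  \<open>2 ^ n \<le> class_size h f n k y * 2 ^ (k * 2 ^ h n)\<close>. For fixed \<open>h\<close>
  and \<open>f\<close> the result depends on \<open>n\<close> and \<open>k\<close> alone, so a
  decoder can recompute it without being told the residues.\<close>

definition large_class ::
    "(nat \<Rightarrow> nat) \<Rightarrow> (nat \<Rightarrow> bool list \<Rightarrow> bool list \<Rightarrow> bool list) \<Rightarrow> nat \<Rightarrow> nat \<Rightarrow> nat" where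
  "large_class h f n k = (LEAST y. 2 ^ n - class_size h f n k y * 2 ^ (k * 2 ^ h n) = 0)"

definition reconstruct ::
    "(nat \<Rightarrow> nat) \<Rightarrow> (nat \<Rightarrow> bool list \<Rightarrow> bool list \<Rightarrow> bool list) \<Rightarrow> nat \<Rightarrow> nat \<Rightarrow> nat \<Rightarrow> nat \<Rightarrow> nat" where
  "reconstruct h f n k \<alpha> q = q * 2 ^ k + residue h f n k (large_class h f n k) \<alpha>"

lemma residue_distance_eq_0_iff:
  "residue_distance h f n k x y = 0 \<longleftrightarrow> (\<forall>\<alpha><2 ^ h n. residue h f n k x \<alpha> = residue h f n k y \<alpha>)"
  unfolding residue_distance_def by (auto simp: order.antisym)

lemma class_size_eq_card:
  "class_size h f n k y = card {x. x < 2 ^ n \<and> residue_distance h f n k x y = 0}"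
proof -
  have "class_size h f n k y = (\<Sum>x<2 ^ n. if residue_distance h f n k x y = 0 then 1 else 0)"
    unfolding class_size_def by (rule sum.cong) auto
  also have "\<dots> = card ({..<2 ^ n} \<inter> {x. residue_distance h f n k x y = 0})"
    by (subst sum.inter_filter[symmetric]) (auto simp: Int_def)
  finally show ?thesis by (simp add: Int_def)
qed

text \<open>Pigeonhole on residue vectors: \<open>2 ^ h n\<close> entries, each below
  \<open>2 ^ k\<close>, allow \<open>2 ^ (k * 2 ^ h n)\<close> vectors. Any member of a fullest
  fibre serves as \<open>y\<close>.\<close>

lemma ex_large_class:
  "\<exists>y. 2 ^ n \<le> class_size h f n k y * 2 ^ (k * 2 ^ h n)"
proof -
  let ?B = "{..<(2::nat) ^ h n} \<rightarrow>\<^sub>E {..<(2::nat) ^ k}"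
  let ?g = "\<lambda>x. restrict (residue h f n k x) {..<2 ^ h n}"
  have "?g \<in> {..<2 ^ n} \<rightarrow> ?B" by (auto simp: residue_def)
  moreover have "finite ?B" by (intro finite_PiE) auto
  moreover have "?B \<noteq> {}" by (simp add: PiE_eq_empty_iff lessThan_empty_iff)
  ultimately obtain b where
    b: "card ({..<2 ^ n} :: nat set) \<le> card (?g -` {b} \<inter> {..<2 ^ n}) * card ?B"
    using pigeonhole_card[of ?g "{..<2 ^ n}" ?B] by blast
  have card_B: "card ?B = 2 ^ (k * 2 ^ h n)" by (simp add: card_funcsetE power_mult)
  \<comment> \<open>An empty fibre would turn \<open>b\<close> into
    \<open>2 ^ n \<le> 0\<close>.\<close>
  have "?g -` {b} \<inter> {..<2 ^ n} \<noteq> {}" using b by fastforce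
  then obtain y where y: "?g y = b" by blast
  have "?g -` {b} \<inter> {..<2 ^ n} = {x. x < 2 ^ n \<and> residue_distance h f n k x y = 0}"
    unfolding residue_distance_eq_0_iff y[symmetric]
    by (auto intro!: restrict_ext) (metis lessThan_iff restrict_apply')
  then show ?thesis using b unfolding card_B class_size_eq_card by auto
qed

lemma large_class_le: "2 ^ n \<le> class_size h f n k (large_class h f n k) * 2 ^ (k * 2 ^ h n)"
proof -
  have "\<exists>y. 2 ^ n - class_size h f n k y * 2 ^ (k * 2 ^ h n) = 0"
    using ex_large_class by simp
  from LeastI_ex[OF this] show ?thesis by (simp add: large_class_def)
qed

section \<open>Computability of the search and of the reconstruction\<close>

text \<open>The hypothesis \<open>f\<close> covers only strings of the right lengths; after
  reduction, \<open>X\<close> and \<open>A\<close> are always codes of such strings.\<close>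

lemma computable_fun_ensemble_code:
  assumes h: "computable_nat h" and f: "computable_ensemble h f"
    and n: "computable_fun a n" and x: "computable_fun a x" and \<alpha>: "computable_fun a \<alpha>"
  shows "computable_fun a (\<lambda>xs. ensemble_code h f (n xs) (x xs) (\<alpha> xs))"
proof -
  obtain r where r: "\<And>n x \<alpha>. x \<in> bitstrings n \<Longrightarrow> \<alpha> \<in> bitstrings (h n) \<Longrightarrow>
      eval r [n, str_code x, str_code \<alpha>] = Some (str_code (f n x \<alpha>))"
    using f unfolding computable_ensemble_def by blast
  define X where "X = (\<lambda>xs. 2 ^ n xs - 1 + x xs mod 2 ^ n xs)"
  define A where "A = (\<lambda>xs. 2 ^ h (n xs) - 1 + \<alpha> xs mod 2 ^ h (n xs))"
  have "computable_fun a X" "computable_fun a A"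
    unfolding X_def A_def
    by (intro computable_fun_arith computable_nat_comp[OF h] n x \<alpha>)+
  then obtain rn rx ra where R: "\<And>xs. length xs = a \<Longrightarrow> eval rn xs = Some (n xs)"
      "\<And>xs. length xs = a \<Longrightarrow> eval rx xs = Some (X xs)"
      "\<And>xs. length xs = a \<Longrightarrow> eval ra xs = Some (A xs)"
    using n unfolding computable_fun_def by metis
  have "eval (Comp r [rn, rx, ra]) xs = Some (ensemble_code h f (n xs) (x xs) (\<alpha> xs))"
    if "length xs = a" for xs
    using r[of "nth_string (n xs) (x xs mod 2 ^ n xs)" "n xs"
        "nth_string (h (n xs)) (\<alpha> xs mod 2 ^ h (n xs))"]
    by (simp add: R[OF that] nth_string_bitstrings str_code_nth_string X_def A_def
        ensemble_code_def)
  then show ?thesis unfolding computable_fun_def by blast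
qed

context
  fixes h :: "nat \<Rightarrow> nat" and f :: "nat \<Rightarrow> bool list \<Rightarrow> bool list \<Rightarrow> bool list"
  assumes h: "computable_nat h" and f: "computable_ensemble h f"
begin

lemma computable_fun_residue:
  assumes "computable_fun a n" "computable_fun a k" "computable_fun a x" "computable_fun a \<alpha>"
  shows "computable_fun a (\<lambda>xs. residue h f (n xs) (k xs) (x xs) (\<alpha> xs))"
  unfolding residue_def
  by (intro computable_fun_arith computable_fun_ensemble_code[OF h f] assms)

lemma computable_fun_residue_distance:
  assumes "computable_fun a n" "computable_fun a k" "computable_fun a x" "computable_fun a y"
  shows "computable_fun a (\<lambda>xs. residue_distance h f (n xs) (k xs) (x xs) (y xs))"
  unfolding residue_distance_def
  by (intro computable_fun_sum computable_fun_arith computable_fun_residue computable_nat_comp[OF h]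
      assms assms[THEN computable_fun_tl] computable_fun_hd) simp_all

lemma computable_fun_class_size:
  assumes "computable_fun a n" "computable_fun a k" "computable_fun a y"
  shows "computable_fun a (\<lambda>xs. class_size h f (n xs) (k xs) (y xs))"
  unfolding class_size_def
  by (intro computable_fun_sum computable_fun_arith computable_fun_residue_distance
      assms assms[THEN computable_fun_tl] computable_fun_hd) simp_all

lemma computable_fun_large_class:
  assumes "computable_fun a n" "computable_fun a k"
  shows "computable_fun a (\<lambda>xs. large_class h f (n xs) (k xs))"
  unfolding large_class_def
proof (rule computable_fun_Least)
  fix xs show "\<exists>y. 2 ^ n xs - class_size h f (n xs) (k xs) y * 2 ^ (k xs * 2 ^ h (n xs)) = 0"
    using ex_large_class by simp
qed (intro computable_fun_arith computable_fun_class_size computable_nat_comp[OF h]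
      assms assms[THEN computable_fun_tl] computable_fun_hd, simp_all)

lemma computable_fun_reconstruct:
  assumes "computable_fun a n" "computable_fun a k" "computable_fun a \<alpha>" "computable_fun a q"
  shows "computable_fun a (\<lambda>xs. reconstruct h f (n xs) (k xs) (\<alpha> xs) (q xs))"
  unfolding reconstruct_def
  by (intro computable_fun_arith computable_fun_residue computable_fun_large_class assms)

end

section \<open>Self-delimiting encoding of descriptions\<close>

text \<open>A description of \<open>(n, k, \<alpha>, q)\<close> is a number \<open>p\<close> with \<open>p + 1 = 2\<^sup>j (2 r + 1)\<close>, where the base
  \<open>2\<^sup>j\<close> digits of \<open>r\<close> are \<open>\<alpha>\<close>, \<open>k\<close>, \<open>n\<close>, followed by \<open>q\<close>; the trailing zeros delimit the digit size.\<close>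

definition digit_size :: "nat \<Rightarrow> nat" where
  "digit_size p = (LEAST j. 1 - Suc p mod 2 ^ Suc j = 0)"

definition payload :: "nat \<Rightarrow> nat" where
  "payload p = Suc p div 2 ^ Suc (digit_size p)"

definition digit :: "nat \<Rightarrow> nat \<Rightarrow> nat" where
  "digit i p = (payload p div 2 ^ (i * digit_size p)) mod 2 ^ digit_size p"

definition decoder ::
    "(nat \<Rightarrow> nat) \<Rightarrow> (nat \<Rightarrow> bool list \<Rightarrow> bool list \<Rightarrow> bool list) \<Rightarrow> nat \<Rightarrow> nat" where
  "decoder h f p =
     reconstruct h f (digit 2 p) (digit 1 p) (digit 0 p) (payload p div 2 ^ (3 * digit_size p))"

lemma computable_fun_digit_size:
  assumes "computable_fun a p"
  shows "computable_fun a (\<lambda>xs. digit_size (p xs))"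
  unfolding digit_size_def
proof (rule computable_fun_Least)
  fix xs
  \<comment> \<open>The witness is \<open>j = Suc (p xs)\<close>: its modulus exceeds
    \<open>Suc (p xs)\<close>, so the remainder is \<open>Suc (p xs)\<close> itself and is not
    zero.\<close>
  have "Suc (p xs) < 2 ^ Suc (Suc (p xs))"
    using less_exp[of "Suc (Suc (p xs))"] by linarith
  then have "1 - Suc (p xs) mod 2 ^ Suc (Suc (p xs)) = 0" by (subst mod_less) auto
  then show "\<exists>j. 1 - Suc (p xs) mod 2 ^ Suc j = 0" ..
qed (intro computable_fun_arith assms[THEN computable_fun_tl] computable_fun_hd, simp)

lemma computable_fun_decoder:
  assumes "computable_nat h" "computable_ensemble h f"
  shows "computable_fun 1 (\<lambda>xs. decoder h f (xs ! 0))"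
  unfolding decoder_def digit_def payload_def
  by (intro computable_fun_reconstruct[OF assms] computable_fun_arith computable_fun_digit_size
      computable_fun_nth) simp_all

text \<open>The cofactor \<open>2 * r + 1\<close> is odd, so \<open>2 ^ j\<close> is the exact power
  of two in \<open>Suc p\<close>; one further halving removes the marker bit and leaves
  \<open>r\<close>.\<close>

lemma
  assumes "Suc p = 2 ^ j * (2 * r + 1)"
  shows digit_size_eq: "digit_size p = j" and payload_eq: "payload p = r"
proof -
  show *: "digit_size p = j"
    unfolding digit_size_def
  proof (rule Least_equality)
    have "Suc p mod 2 ^ Suc j = 2 ^ j * ((2 * r + 1) mod 2)"
      unfolding assms power_Suc2 by (rule mult_mod_right[symmetric])
    then show "1 - Suc p mod 2 ^ Suc j = 0" by simp
  next
    fix i assume i: "1 - Suc p mod 2 ^ Suc i = 0"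
    show "j \<le> i"
    proof (rule ccontr)
      assume "\<not> j \<le> i"
      then have "(2::nat) ^ Suc i dvd 2 ^ j" by (intro le_imp_power_dvd) simp
      then have "2 ^ Suc i dvd Suc p" unfolding assms by simp
      then show False using i by (simp add: mod_eq_0_iff_dvd)
    qed
  qed
  show "payload p = r"
    unfolding payload_def * assms power_Suc2 by (subst div_mult_mult1) simp_all
qed

lemma decoder_eq:
  assumes "n < 2 ^ j" "k < 2 ^ j" "\<alpha> < 2 ^ j"
    and p: "Suc p = 2 ^ j * (2 * (((q * 2 ^ j + n) * 2 ^ j + k) * 2 ^ j + \<alpha>) + 1)"
  shows "decoder h f p = reconstruct h f n k \<alpha> q"
proof -
  let ?r = "((q * 2 ^ j + n) * 2 ^ j + k) * 2 ^ j + \<alpha>"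
  have 1: "?r div 2 ^ j = (q * 2 ^ j + n) * 2 ^ j + k" using assms by simp
  have 2: "?r div 2 ^ (2 * j) = q * 2 ^ j + n"
    unfolding mult_2 power_add div_mult2_eq 1 using assms by simp
  have 3: "?r div 2 ^ (3 * j) = q"
  proof -
    have "3 * j = 2 * j + j" by simp
    then have "?r div 2 ^ (3 * j) = ?r div 2 ^ (2 * j) div 2 ^ j"
      by (simp only: power_add div_mult2_eq)
    then show ?thesis unfolding 2 using assms by simp
  qed
  have "digit 0 p = \<alpha>" "digit 1 p = k" "digit 2 p = n"
    unfolding digit_def digit_size_eq[OF p] payload_eq[OF p] using 1 2 assms by simp_all
  then show ?thesis
    unfolding decoder_def digit_size_eq[OF p] payload_eq[OF p] 3 by simp
qed


text \<open>Bit count: \<open>j\<close> trailing zeros, one marker bit, three digits of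
  \<open>j\<close> bits each, and \<open>l\<close> bits for \<open>q\<close>.\<close>

lemma decoder_description:
  assumes "n < 2 ^ j" "k < 2 ^ j" "\<alpha> < 2 ^ j" "q < 2 ^ l"
  obtains p where "decoder h f p = reconstruct h f n k \<alpha> q" "Suc p \<le> 2 ^ (4 * j + l + 1)"
proof -
  let ?r = "((q * 2 ^ j + n) * 2 ^ j + k) * 2 ^ j + \<alpha>"
  \<comment> \<open>One Horner step: appending a base \<open>2 ^ j\<close> digit multiplies the
    strict upper bound by \<open>2 ^ j\<close>.\<close>
  have step: "Suc (a * 2 ^ j + b) \<le> Suc a * 2 ^ j" if "b < 2 ^ j" for a b :: nat
    using that by simp
  have "Suc ?r \<le> Suc ((q * 2 ^ j + n) * 2 ^ j + k) * 2 ^ j"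
    by (rule step) fact
  also have "\<dots> \<le> (Suc (q * 2 ^ j + n) * 2 ^ j) * 2 ^ j"
    by (intro mult_right_mono step) (use assms in auto)
  also have "\<dots> \<le> ((Suc q * 2 ^ j) * 2 ^ j) * 2 ^ j"
    by (intro mult_right_mono step) (use assms in auto)
  also have "\<dots> \<le> ((2 ^ l * 2 ^ j) * 2 ^ j) * 2 ^ j"
    by (intro mult_right_mono) (use assms in auto)
  finally have r: "Suc ?r \<le> 2 ^ (3 * j + l)"
    by (simp add: power_add numeral_3_eq_3 mult_ac)
  have "2 ^ j * (2 * ?r + 1) \<le> 2 ^ j * (2 * Suc ?r)"
    by (intro mult_left_mono) auto
  also have "\<dots> \<le> 2 ^ j * (2 * 2 ^ (3 * j + l))"
    using r by (intro mult_left_mono) auto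
  also have "\<dots> = 2 ^ (j + Suc (3 * j + l))"
    by (simp only: power_add power_Suc)
  also have "j + Suc (3 * j + l) = 4 * j + l + 1"
    by simp
  finally have le: "2 ^ j * (2 * ?r + 1) \<le> 2 ^ (4 * j + l + 1)" .
  have pos: "0 < 2 ^ j * (2 * ?r + 1)" by simp
  define p where "p = 2 ^ j * (2 * ?r + 1) - 1"
  have "Suc p = 2 ^ j * (2 * ?r + 1)" using pos unfolding p_def by linarith
  with le decoder_eq[OF assms(1-3) this] that show thesis by metis
qed

section \<open>A complex string whose images are all compressible\<close>

text \<open>The large class has at least \<open>2 ^ (n - k * 2 ^ h n)\<close> members, hence at
  least \<open>2 ^ t\<close>, and the counting of programs applies to it.\<close>

lemma ex_complex_string_in_large_class:
  assumes U: "universal_machine U" and t: "k * 2 ^ h n + t \<le> n"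
  obtains x where "x < 2 ^ n" "t \<le> plain_complexity U (nth_string n x)"
    and "\<And>\<alpha>. \<alpha> < 2 ^ h n \<Longrightarrow> residue h f n k x \<alpha> = residue h f n k (large_class h f n k) \<alpha>"
proof -
  let ?y = "large_class h f n k"
  let ?S = "{x. x < 2 ^ n \<and> residue_distance h f n k x ?y = 0}"
  have "(2::nat) ^ t * 2 ^ (k * 2 ^ h n) \<le> 2 ^ n"
    using t by (simp add: add.commute flip: power_add)
  also have "\<dots> \<le> card ?S * 2 ^ (k * 2 ^ h n)"
    using large_class_le unfolding class_size_eq_card .
  finally have "2 ^ t \<le> card ?S" by simp
  also have "card ?S = card (nth_string n ` ?S)"
    by (intro card_image[symmetric] inj_on_subset[OF inj_nth_string]) simp
  finally obtain x where "x \<in> ?S" "t \<le> plain_complexity U (nth_string n x)"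
    using ex_complex_string[OF U, of "nth_string n ` ?S" t] by auto
  then show thesis using that residue_distance_eq_0_iff by blast
qed

text \<open>The \<open>k\<close> low-order bits of each image code come from
  \<open>large_class\<close>, so a program supplies only the quotient and the parameters. The
  machine \<open>V\<close> is fixed before \<open>n\<close>, \<open>k\<close>, \<open>t\<close> and
  \<open>j\<close>, which makes \<open>c\<close> uniform.\<close>

lemma ex_complex_string_with_simple_images:
  assumes U: "universal_machine U" and h: "computable_nat h" and f: "computable_ensemble h f"
  obtains c where "\<And>n k t j. k * 2 ^ h n + t \<le> n \<Longrightarrow> n < 2 ^ j \<Longrightarrow> h n \<le> j \<Longrightarrow>
    \<exists>x \<in> bitstrings n. t \<le> plain_complexity U x \<and>
      (\<forall>\<alpha> \<in> bitstrings (h n).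
         plain_complexity U (f n x \<alpha>) \<le> length (f n x \<alpha>) - k + 4 * j + 2 + c)"
proof -
  define V where "V p = Some (inv str_code (decoder h f (str_code p)))" for p
  obtain r where "\<And>xs. length xs = 1 \<Longrightarrow> eval r xs = Some (decoder h f (xs ! 0))"
    using computable_fun_decoder[OF h f] unfolding computable_fun_def by blast
  then have "partial_computable V"
    unfolding partial_computable_def V_def by (intro exI[of _ r]) (simp add: str_code_inv)
  then obtain c where c: "\<And>p u. V p = Some u \<Longrightarrow> plain_complexity U u \<le> length p + c"
    using plain_complexity_le_machine[OF U] by blast
  show thesis
  proof (rule that[of c])
    fix n k t j assume t: "k * 2 ^ h n + t \<le> n" and n: "n < 2 ^ j" and hj: "h n \<le> j"
    obtain x where x: "x < 2 ^ n" "t \<le> plain_complexity U (nth_string n x)"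
      and eq: "\<And>\<alpha>. \<alpha> < 2 ^ h n \<Longrightarrow>
        residue h f n k x \<alpha> = residue h f n k (large_class h f n k) \<alpha>"
      using ex_complex_string_in_large_class[where f = f and h = h and n = n and k = k and t = t, OF U t] by blast
    \<comment> \<open>Together with \<open>t\<close> this gives \<open>k \<le> n\<close>, so
      \<open>k\<close> fits into one digit of \<open>j\<close> bits.\<close>
    have "k \<le> k * 2 ^ h n" by simp
    then have k: "k < 2 ^ j" using t n by linarith
    have "plain_complexity U (f n (nth_string n x) \<alpha>)
        \<le> length (f n (nth_string n x) \<alpha>) - k + 4 * j + 2 + c"
      if \<alpha>: "\<alpha> \<in> bitstrings (h n)" for \<alpha>
    proof -
      obtain a where a: "a < 2 ^ h n" "\<alpha> = nth_string (h n) a"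
        using \<alpha> by (rule ex_nth_string)
      let ?u = "f n (nth_string n x) \<alpha>"
      \<comment> \<open>The successor is due to codes of strings of length \<open>l\<close> reaching
        up to \<open>2 ^ Suc l - 2\<close>. The choice also covers \<open>k > length ?u\<close>,
        where the difference is truncated to 0.\<close>
      let ?l = "Suc (length ?u - k)"
      have code: "ensemble_code h f n x a = str_code ?u"
        using x a by (simp add: ensemble_code_def)
      have "str_code ?u < 2 ^ Suc (length ?u)" using str_code_upper[of ?u] by simp
      also have "(2::nat) ^ Suc (length ?u) \<le> 2 ^ (?l + k)" by (intro power_increasing) auto
      finally have q: "str_code ?u div 2 ^ k < 2 ^ ?l"
        by (simp add: div_less_iff_less_mult power_add)
      have "(2::nat) ^ h n \<le> 2 ^ j" using hj by (intro power_increasing) auto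
      then have "a < 2 ^ j" using a by linarith
      then obtain p where p: "decoder h f p = reconstruct h f n k a (str_code ?u div 2 ^ k)"
        "Suc p \<le> 2 ^ (4 * j + ?l + 1)"
        using decoder_description[OF n k _ q] by blast
      have res: "residue h f n k (large_class h f n k) a = str_code ?u mod 2 ^ k"
        using eq[OF a(1)] code by (simp add: residue_def)
      have "decoder h f p = str_code ?u"
        unfolding p(1) reconstruct_def res by (rule div_mult_mod_eq)
      then have "V (inv str_code p) = Some ?u"
        by (simp add: V_def str_code_inv inv_str_code)
      then have "plain_complexity U ?u \<le> length (inv str_code p) + c" by (rule c)
      moreover have "(2::nat) ^ length (inv str_code p) \<le> 2 ^ (4 * j + ?l + 1)"
        using str_code_lower[of "inv str_code p"] p(2) by (simp add: str_code_inv)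
      then have "length (inv str_code p) \<le> 4 * j + ?l + 1"
        by (rule power_le_imp_le_exp[rotated]) simp
      ultimately show ?thesis by simp
    qed
    then show "\<exists>x \<in> bitstrings n. t \<le> plain_complexity U x \<and>
      (\<forall>\<alpha> \<in> bitstrings (h n).
         plain_complexity U (f n x \<alpha>) \<le> length (f n x \<alpha>) - k + 4 * j + 2 + c)"
      using x nth_string_bitstrings by blast
  qed
qed

section \<open>Choice of parameters and the lower bound on the error\<close>

theorem theorem6:
  fixes U :: "bool list \<Rightarrow> bool list option"
    and m h :: "nat \<Rightarrow> nat"
    and \<sigma> \<epsilon> :: "nat \<Rightarrow> real"
    and f :: "nat \<Rightarrow> bool list \<Rightarrow> bool list \<Rightarrow> bool list"
  assumes "universal_machine U"
    and "computable_nat m" and "computable_nat h" and "computable_real_seq \<sigma>"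
    and "\<forall>n\<ge>2. 0 < \<sigma> n \<and> \<sigma> n < 1"
    and "\<forall>n\<ge>2. 0 < h n"
    and "\<forall>n\<ge>2. 0 < m n \<and> m n < n"
    and "(\<lambda>n. real (m n)) \<in> \<omega>(\<lambda>n. log 2 (real n) + real (h n))"
    and "computable_ensemble h f"
    and "\<forall>n\<ge>2. \<forall>x \<in> bitstrings n. \<forall>\<alpha> \<in> bitstrings (h n). f n x \<alpha> \<in> bitstrings (m n)"
    and "\<forall>n\<ge>2. \<forall>x \<in> bitstrings n. real (plain_complexity U x) \<ge> \<sigma> n * real n \<longrightarrow>
           (\<exists>\<alpha> \<in> bitstrings (h n).
              real (plain_complexity U (f n x \<alpha>)) \<ge> (1 - \<epsilon> n) * real (m n))"
  shows "\<exists>\<delta> :: nat \<Rightarrow> real. \<delta> \<in> o(\<lambda>_. 1) \<and>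
           (\<forall>n\<ge>2. \<epsilon> n \<ge> (1 - \<sigma> n) / (2 ^ (h n + 1) - 1) - \<delta> n)"
proof -
  note U = assms(1) and h = assms(3) and \<sigma> = assms(5) and m = assms(7) and f = assms(9)
  obtain c where c: "\<And>n k t j. k * 2 ^ h n + t \<le> n \<Longrightarrow> n < 2 ^ j \<Longrightarrow> h n \<le> j \<Longrightarrow>
      \<exists>x \<in> bitstrings n. t \<le> plain_complexity U x \<and>
        (\<forall>\<alpha> \<in> bitstrings (h n).
           plain_complexity U (f n x \<alpha>) \<le> length (f n x \<alpha>) - k + 4 * j + 2 + c)"
    using ex_complex_string_with_simple_images[OF U h f] by blast
  define g where "g n = log 2 (real n) + real (h n)" for n
  \<comment> \<open>The total loss will be \<open>4 * g n + 7 + c\<close>: besides \<open>c\<close>,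
    the bound on the images adds 2, \<open>j \<le> g n + 1\<close> adds 4 and rounding
    \<open>k\<close> down adds 1. As \<open>g n \<ge> 1\<close>, this is at most
    \<open>(11 + c) * g n\<close>.\<close>
  define \<delta> where "\<delta> n = real (11 + c) * (g n / real (m n))" for n
  have "g \<in> o(\<lambda>n. real (m n))"
    using assms(8) unfolding g_def by (simp add: smallomega_iff_smallo)
  then have "\<delta> \<longlonglongrightarrow> 0"
    unfolding \<delta>_def by (intro tendsto_mult_right_zero smalloD_tendsto)
  then have "\<delta> \<in> o(\<lambda>_. 1)" by (intro smalloI_tendsto) auto
  moreover have "\<epsilon> n \<ge> (1 - \<sigma> n) / (2 ^ (h n + 1) - 1) - \<delta> n" if n: "n \<ge> 2" for n
  proof -
    define H where "H = (2::real) ^ (h n + 1) - 1"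
    \<comment> \<open>The residues cost \<open>k * 2 ^ h n\<close> bits. Dividing by
      \<open>H \<ge> 2 ^ h n\<close> keeps this within \<open>(1 - \<sigma> n) * m n\<close>, hence
      within \<open>(1 - \<sigma> n) * n\<close>, and leaves room for \<open>t\<close>.\<close>
    define k where "k = nat \<lfloor>(1 - \<sigma> n) * real (m n) / H\<rfloor>"
    define t where "t = nat \<lceil>\<sigma> n * real n\<rceil>"
    \<comment> \<open>The second summand alone ensures \<open>n < 2 ^ j\<close>, the first
      \<open>h n \<le> j\<close>; their sum stays within \<open>g n + 1\<close>.\<close>
    define j where "j = h n + Suc (nat \<lfloor>log 2 (real n)\<rfloor>)"
    have s: "0 < \<sigma> n" "\<sigma> n < 1" and mn: "0 < m n" "m n < n"
      using \<sigma> m n by auto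
    have one: "(1::real) \<le> 2 ^ h n" by simp
    have NH: "2 ^ h n \<le> H" unfolding H_def power_add using one by simp
    have H0: "0 < H" using one NH by linarith
    have k0: "0 \<le> (1 - \<sigma> n) * real (m n) / H" using s H0 by simp
    have k_le: "real k \<le> (1 - \<sigma> n) * real (m n) / H"
      unfolding k_def using k0 by simp
    have k_ge: "(1 - \<sigma> n) * real (m n) / H - 1 \<le> real k"
      unfolding k_def using k0 by linarith
    have "real k * 2 ^ h n \<le> real k * H"
      using NH by (intro mult_left_mono) auto
    also have kH: "\<dots> \<le> (1 - \<sigma> n) * real (m n)"
      using k_le H0 by (simp add: field_simps)
    also have "\<dots> \<le> (1 - \<sigma> n) * real n"
      using s mn by (intro mult_left_mono) auto
    finally have "real (k * 2 ^ h n) \<le> real n - \<sigma> n * real n"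
      by (simp add: algebra_simps)
    \<comment> \<open>Rounding \<open>\<sigma> n * real n\<close> up is harmless because the other
      two quantities are integers.\<close>
    then have "int (k * 2 ^ h n) + \<lceil>\<sigma> n * real n\<rceil> \<le> int n"
      by linarith
    moreover have "0 \<le> \<sigma> n * real n" using s by simp
    then have "0 \<le> \<lceil>\<sigma> n * real n\<rceil>" by linarith
    ultimately have kt: "k * 2 ^ h n + t \<le> n" unfolding t_def by linarith
    \<comment> \<open>With \<open>k \<le> m n\<close> the truncated
      \<open>length (f n x \<alpha>) - k\<close> agrees with real subtraction.\<close>
    have km: "k \<le> m n"
    proof -
      have "real k * 1 \<le> real k * H" using order_trans[OF one NH] by (intro mult_left_mono) auto
      also note kH
      also have "(1 - \<sigma> n) * real (m n) \<le> 1 * real (m n)"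
        using s by (intro mult_right_mono) auto
      finally show ?thesis by simp
    qed
    have log1: "1 \<le> log 2 (real n)" using n by simp
    have nj: "n < 2 ^ j"
    proof -
      have "log 2 (real n) < real j" unfolding j_def using log1 by linarith
      then have "real n < 2 powr real j" using n by (simp add: log_less_iff)
      then have "real n < real (2 ^ j)" by (simp add: powr_realpow)
      then show ?thesis by (simp only: of_nat_less_iff)
    qed
    have j_le: "real j \<le> g n + 1" unfolding j_def g_def using log1 by linarith
    have hj: "h n \<le> j" unfolding j_def by simp
    obtain x where x: "x \<in> bitstrings n" "t \<le> plain_complexity U x"
      and le: "\<And>\<alpha>. \<alpha> \<in> bitstrings (h n) \<Longrightarrow>
        plain_complexity U (f n x \<alpha>) \<le> length (f n x \<alpha>) - k + 4 * j + 2 + c"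
      using c[OF kt nj hj] by blast
    have "\<sigma> n * real n \<le> real (plain_complexity U x)"
      using x(2) unfolding t_def by linarith
    then obtain \<alpha> where \<alpha>: "\<alpha> \<in> bitstrings (h n)"
      and ge: "(1 - \<epsilon> n) * real (m n) \<le> real (plain_complexity U (f n x \<alpha>))"
      using assms(11) n x(1) by blast
    have "length (f n x \<alpha>) = m n"
      using assms(10) n x(1) \<alpha> by (simp add: bitstrings_def)
    then have "real (plain_complexity U (f n x \<alpha>)) \<le> real (m n) - real k + 4 * real j + 2 + real c"
      using le[OF \<alpha>] km by linarith
    then have "(1 - \<sigma> n) * real (m n) / H - \<epsilon> n * real (m n) \<le> 4 * g n + (7 + real c)"
      using ge k_ge j_le by (simp add: algebra_simps)
    also have "\<dots> \<le> 4 * g n + (7 + real c) * g n"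
      using mult_left_mono[of 1 "g n" "7 + real c"] log1 unfolding g_def by simp
    also have "\<dots> = \<delta> n * real (m n)"
      unfolding \<delta>_def using mn by (simp add: algebra_simps)
    finally have "((1 - \<sigma> n) / H - \<delta> n) * real (m n) \<le> \<epsilon> n * real (m n)"
      by (simp add: algebra_simps)
    then show ?thesis using mn unfolding H_def by (simp del: power_add power_Suc)
  qed
  ultimately show ?thesis by blast
qed

end
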